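(* Let $s\ge 1$ and $L\ge 3$ be integers. There exists an integer $M_{L,s}$, depending on $L$ and $s$, such that for every integer $k$ with $\max\{s+1,L\}\le k\le s+L$ and every integer $n\ge M_{L,s}$, \[ f_{L,s,k}(n)\ge c_{L,s,2}(n). \]
   Context: For positive integers $L,s,n$: $c_{L,s,2}(n)$ denotes the number of partitions of $n$ all of whose parts lie in $\{s+1,\ldots,s+L\}$. For positive integers $L,s,k,n$: $f_{L,s,k}(n)$ denotes the number of partitions of $n$ whose smallest part equals $s$, whose largest part is at most $L+s$, and which have no part equal to $k$. *)

theory Defs
  imports Main "HOL-Library.Multiset"
begin

definition partitions_of :: "nat \<Rightarrow> nat multiset set" where
  "partitions_of n = {p. (\<forall>i\<in>#p. 0 < i) \<and> sum_mset p = n}"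

definition c2_count :: "nat \<Rightarrow> nat \<Rightarrow> nat \<Rightarrow> nat" where
  "c2_count L s n = card {p \<in> partitions_of n. set_mset p \<subseteq> {s+1..s+L}}"

text \<open>The smallest part exists only for a nonempty partition.\<close>

definition f_count :: "nat \<Rightarrow> nat \<Rightarrow> nat \<Rightarrow> nat \<Rightarrow> nat" where
  "f_count L s k n = card {p \<in> partitions_of n.
     p \<noteq> {#} \<and> Min (set_mset p) = s \<and> Max (set_mset p) \<le> L + s \<and> k \<notin># p}"

text \<open>The sets counted above are finite, so \<^const>\<open>card\<close> is the true cardinality.\<close>

lemma finite_partitions_of: "finite (partitions_of n)"
proof -
  have "size p \<le> sum_mset p \<and> set_mset p \<subseteq> {..sum_mset p}"
    if "\<forall>i\<in>#p. 0 < i" for p :: "nat multiset"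
    using that by (induction p) (auto intro: trans_le_add1 trans_le_add2 simp: subset_iff)
  then have "partitions_of n \<subseteq> mset ` {xs. set xs \<subseteq> {..n} \<and> length xs \<le> n}"
    unfolding partitions_of_def
    by (smt (verit) ex_mset image_iff mem_Collect_eq set_mset_mset size_mset subsetI)
  then show ?thesis
    by (rule finite_subset) (simp add: finite_lists_length_le)
qed

end

theory Submission
  imports Defs Complex_Main
begin

text \<open>
  Both sides count partitions into \<open>L\<close> prescribed part sizes: \<open>c2_count L s n\<close> uses
  \<open>{s+1..s+L}\<close>, while removing one part \<open>s\<close> shows that \<open>f_count L s k n\<close> counts the partitions of
  \<open>n - s\<close> into parts from \<open>{s..s+L} - {k}\<close>. The number of partitions of \<open>n\<close> into parts from a
  finite set \<open>A\<close> of size \<open>m\<close> is asymptotic to \<open>n ^ (m - 1) / ((m - 1)! * \<Prod>A)\<close> as soon as \<open>A\<close>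
  contains two consecutive integers. As \<open>L \<ge> 3\<close> this applies to both sets, and the ratio of the
  leading coefficients is \<open>k / s > 1\<close>.
\<close>

section \<open>Partitions with prescribed part sizes and their recurrence\<close>

definition partitions_into :: "nat set \<Rightarrow> nat \<Rightarrow> nat multiset set" where
  "partitions_into A n = {p. set_mset p \<subseteq> A \<and> sum_mset p = n}"

lemma finite_partitions_into:
  assumes "0 \<notin> A"
  shows "finite (partitions_into A n)"
proof (rule finite_subset[OF _ finite_partitions_of[of n]])
  show "partitions_into A n \<subseteq> partitions_of n"
    using assms by (auto simp: partitions_into_def partitions_of_def intro!: gr0I)
qed

text \<open>Split by whether \<open>b\<close> occurs; if it does, deleting one copy of
  \<open>b\<close> leaves a partition of \<open>n - b\<close> that may still contain
  \<open>b\<close>.\<close>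

lemma card_partitions_into_insert:
  assumes "b \<notin> A" "0 \<notin> A" "b > 0"
  shows "card (partitions_into (insert b A) n) = card (partitions_into A n)
    + (if b \<le> n then card (partitions_into (insert b A) (n - b)) else 0)"
proof -
  let ?Q = "if b \<le> n then add_mset b ` partitions_into (insert b A) (n - b) else {}"
  have "partitions_into (insert b A) n = partitions_into A n \<union> ?Q"
  proof (intro set_eqI iffI)
    fix p assume p: "p \<in> partitions_into (insert b A) n"
    show "p \<in> partitions_into A n \<union> ?Q"
    proof (cases "b \<in># p")
      case True
      then obtain q where q: "p = add_mset b q"
        by (metis mset_add)
      with p show ?thesis
        by (auto simp: partitions_into_def)
    next
      case False
      with p show ?thesis
        by (auto simp: partitions_into_def)
    qed
  qed (auto simp: partitions_into_def split: if_splits)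
  moreover have "partitions_into A n \<inter> ?Q = {}"
  proof -
    have "b \<notin># p" if "p \<in> partitions_into A n" for p
      using that assms(1) by (auto simp: partitions_into_def)
    moreover have "b \<in># p" if "p \<in> ?Q" for p
      using that by (auto split: if_splits)
    ultimately show ?thesis
      by blast
  qed
  moreover have "finite (partitions_into A n)" "finite ?Q"
    using assms by (auto intro!: finite_partitions_into)
  ultimately have "card (partitions_into (insert b A) n) = card (partitions_into A n) + card ?Q"
    by (simp only: card_Un_disjoint)
  moreover have "card (add_mset b ` X) = card X" for X
    by (intro card_image inj_onI) auto
  ultimately show ?thesis
    by auto
qed

section \<open>Two consecutive part sizes\<close>

text \<open>A partition of \<open>n\<close> into parts \<open>a\<close> and \<open>a + 1\<close> is determined by its number of parts.\<close>

lemma card_partitions_into_consecutive: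
  assumes "a > 0"
  shows "card (partitions_into {a, Suc a} n) = Suc (n div a) - (n + a) div Suc a"
proof -
  have rep: "p = replicate_mset (count p a) a + replicate_mset (count p (Suc a)) (Suc a)"
    if "set_mset p \<subseteq> {a, Suc a}" for p
    using that by (intro multiset_eqI) (auto simp: count_eq_zero_iff)
  \<comment> \<open>The sum of \<open>t\<close> parts from \<open>a\<close>, \<open>Suc a\<close>
    takes exactly the values from \<open>t * a\<close> to \<open>t * Suc a\<close>.\<close>
  let ?T = "{t. t * a \<le> n \<and> n \<le> t * Suc a}"
  have "bij_betw size (partitions_into {a, Suc a} n) ?T"
  proof (rule bij_betwI')
    fix p q
    assume pq: "p \<in> partitions_into {a, Suc a} n" "q \<in> partitions_into {a, Suc a} n"
    define x y where "x = count p a" and "y = count p (Suc a)"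
    define u v where "u = count q a" and "v = count q (Suc a)"
    have p: "p = replicate_mset x a + replicate_mset y (Suc a)"
      unfolding x_def y_def using pq(1) by (intro rep) (auto simp: partitions_into_def)
    have q: "q = replicate_mset u a + replicate_mset v (Suc a)"
      unfolding u_def v_def using pq(2) by (intro rep) (auto simp: partitions_into_def)
    have "x * a + y * Suc a = n" "u * a + v * Suc a = n"
      using pq by (auto simp: p q partitions_into_def)
    \<comment> \<open>The sum is \<open>a\<close> times the number of parts plus the number of
      larger parts, so equal sizes force equal multiplicities.\<close>
    then have *: "(x + y) * a + y = (u + v) * a + v"
      by (simp add: algebra_simps)
    show "size p = size q \<longleftrightarrow> p = q"
    proof
      assume "size p = size q"
      then have "x + y = u + v"
        by (simp add: p q)
      with * show "p = q"
        by (simp add: p q)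
    qed simp
  next
    fix p assume pp: "p \<in> partitions_into {a, Suc a} n"
    define x y where "x = count p a" and "y = count p (Suc a)"
    have p: "p = replicate_mset x a + replicate_mset y (Suc a)"
      unfolding x_def y_def using pp by (intro rep) (auto simp: partitions_into_def)
    have "x * a + y * Suc a = n"
      using pp by (auto simp: p partitions_into_def)
    then show "size p \<in> ?T"
      by (auto simp: p algebra_simps)
  next
    fix t assume t: "t \<in> ?T"
    \<comment> \<open>Start from \<open>t\<close> copies of \<open>a\<close> and raise
      \<open>y\<close> of them by one.\<close>
    define y where "y = n - t * a"
    have y: "n = t * a + y" "y \<le> t"
      using t by (auto simp: y_def algebra_simps)
    then obtain x where x: "t = x + y"
      by (metis add.commute le_Suc_ex)
    show "\<exists>p\<in>partitions_into {a, Suc a} n. t = size p"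
      by (rule bexI[of _ "replicate_mset x a + replicate_mset y (Suc a)"])
        (auto simp: partitions_into_def x y(1) algebra_simps split: if_splits)
  qed
  then have "card (partitions_into {a, Suc a} n) = card ?T"
    by (rule bij_betw_same_card)
  also have "?T = {(n + a) div Suc a..n div a}"
  proof -
    \<comment> \<open>\<open>(n + a) div Suc a\<close> is the ceiling of n/(a+1).\<close>
    have "(n + a) div Suc a \<le> t \<longleftrightarrow> n \<le> t * Suc a" for t
      using div_less_iff_less_mult[of "Suc a" "n + a" "Suc t"] by (auto simp: less_Suc_eq_le)
    then show ?thesis
      unfolding set_eq_iff atLeastAtMost_iff mem_Collect_eq less_eq_div_iff_mult_less_eq[OF assms]
      by blast
  qed
  finally show ?thesis
    by simp
qed

text \<open>As n/a - n/(a+1) = n/(a(a+1)), the rounding in floor and ceiling changes the count by at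
  most 1, which is a shift of \<open>n\<close> by \<open>a * Suc a\<close>.\<close>

lemma card_partitions_into_consecutive_bounds:
  assumes "a > 0"
  shows "real (card (partitions_into {a, Suc a} n)) \<le> real (n + a * Suc a) / real (a * Suc a)"
    and "real (n - a * Suc a) / real (a * Suc a) \<le> real (card (partitions_into {a, Suc a} n))"
proof -
  define u v where "u = n div a" and "v = (n + a) div Suc a"
  have "u * a \<le> n" "n \<le> Suc u * a"
    using assms dividend_less_div_times[of a n] by (auto simp: u_def)
  from this[THEN mult_le_mono1, of "Suc a"]
  have u: "real (u * a * Suc a) \<le> real (n * Suc a)" "real (n * Suc a) \<le> real (Suc u * a * Suc a)"
    by (simp_all only: of_nat_le_iff)
  have "v * Suc a \<le> n + a" "n \<le> v * Suc a"
    using dividend_less_div_times[of "Suc a" "n + a"] div_times_less_eq_dividend[of "n + a" "Suc a"]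
    unfolding v_def by (auto simp del: div_times_less_eq_dividend)
  from this[THEN mult_le_mono1, of a]
  have v: "real (v * Suc a * a) \<le> real ((n + a) * a)" "real (n * a) \<le> real (v * Suc a * a)"
    by (simp_all only: of_nat_le_iff)
  have pos: "real (a * Suc a) > 0"
    using assms by (simp only: of_nat_0_less_iff) simp
  have card: "card (partitions_into {a, Suc a} n) = Suc u - v"
    using card_partitions_into_consecutive[OF assms] by (simp add: u_def v_def)
  have "real (Suc u - v) * real (a * Suc a) \<le> real (n + a * Suc a)"
  proof (cases "v \<le> Suc u")
    case True
    then show ?thesis
      using u(1) v(2) by (simp add: of_nat_diff algebra_simps)
  qed simp
  then show "real (card (partitions_into {a, Suc a} n)) \<le> real (n + a * Suc a) / real (a * Suc a)"
    unfolding card pos_le_divide_eq[OF pos] .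
  have "real (n - a * Suc a) \<le> real (Suc u - v) * real (a * Suc a)"
  proof (cases "a * Suc a \<le> n")
    case True
    have "real (n - a * Suc a) \<le> (real (Suc u) - real v) * real (a * Suc a)"
      using True u(2) v(1) by (simp add: of_nat_diff algebra_simps)
    also have "\<dots> \<le> real (Suc u - v) * real (a * Suc a)"
      by (intro mult_right_mono) auto
    finally show ?thesis .
  qed simp
  then show "real (n - a * Suc a) / real (a * Suc a) \<le> real (card (partitions_into {a, Suc a} n))"
    unfolding card pos_divide_le_eq[OF pos] .
qed

section \<open>Shifted-power bounds, carried to general sets of parts\<close>

text \<open>The mean value estimate: the derivative of t^(d+1) on [x, y] lies between its endpoint
  values.\<close>

lemma power_Suc_increment_bounds:
  fixes x y :: real
  assumes "0 \<le> x" "x \<le> y"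
  shows "y ^ Suc d \<le> x ^ Suc d + real (Suc d) * (y - x) * y ^ d"
    and "x ^ Suc d + real (Suc d) * (y - x) * x ^ d \<le> y ^ Suc d"
proof (induction d)
  case (Suc d)
  have mono: "x ^ Suc d \<le> y ^ Suc d"
    using assms by (intro power_mono)
  \<comment> \<open>Both cases use \<open>y * z = x * z + (y - x) * z\<close>, with \<open>z\<close>
    the power \<open>x ^ Suc d\<close> or \<open>y ^ Suc d\<close>.\<close>
  {
    case 1
    have "y * y ^ Suc d \<le> y * (x ^ Suc d + real (Suc d) * (y - x) * y ^ d)"
      using assms Suc.IH(1) by (intro mult_left_mono) auto
    moreover have "(y - x) * x ^ Suc d \<le> (y - x) * y ^ Suc d"
      using assms mono by (intro mult_left_mono) auto
    ultimately show ?case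
      by (simp add: algebra_simps)
  next
    case 2
    have "x * (x ^ Suc d + real (Suc d) * (y - x) * x ^ d) \<le> x * y ^ Suc d"
      using assms Suc.IH(2) by (intro mult_left_mono) auto
    moreover have "(y - x) * x ^ Suc d \<le> (y - x) * y ^ Suc d"
      using assms mono by (intro mult_left_mono) auto
    ultimately show ?case
      by (simp add: algebra_simps)
  }
qed auto

text \<open>
  The error terms are shifts of the argument, the lower one truncated at \<open>0\<close>; in this form the
  bounds are preserved by the recurrence \<open>q n = q (n - b) + p n\<close>.
\<close>

lemma shifted_power_bounds_recurrence:
  fixes p q :: "nat \<Rightarrow> nat" and \<alpha> :: real
  assumes "b > 0" "\<alpha> \<ge> 0"
    and rec: "\<And>n. q n = p n + (if b \<le> n then q (n - b) else 0)"
    and p: "\<And>n. real (p n) \<le> \<alpha> * real (n + c) ^ d" "\<And>n. \<alpha> * real (n - c) ^ d \<le> real (p n)"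
  shows "real (q n) \<le> \<alpha> / (real (Suc d) * real b) * real (n + (c + b)) ^ Suc d"
    and "\<alpha> / (real (Suc d) * real b) * real (n - c) ^ Suc d \<le> real (q n)"
proof -
  \<comment> \<open>Chosen so that a step of length \<open>b\<close> changes \<beta> t^(d+1) by
    about \<alpha> t^d, the contribution of \<open>p\<close>.\<close>
  define \<beta> where "\<beta> = \<alpha> / (real (Suc d) * real b)"
  have \<alpha>: "\<alpha> = \<beta> * (real (Suc d) * real b)" and \<beta>: "\<beta> \<ge> 0"
    using assms by (auto simp: \<beta>_def)
  show "real (q n) \<le> \<alpha> / (real (Suc d) * real b) * real (n + (c + b)) ^ Suc d"
    unfolding \<beta>_def[symmetric]
  proof (induction n rule: less_induct)
    case (less n)
    \<comment> \<open>The shift \<open>c + b\<close> at \<open>n - b\<close> becomes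
      \<open>c\<close> at \<open>n\<close>, leaving a step of \<open>b\<close> to be filled by
      \<open>p n\<close>.\<close>
    have "(if b \<le> n then real (q (n - b)) else 0) \<le> \<beta> * real (n + c) ^ Suc d"
      using less[of "n - b"] \<open>b > 0\<close> \<beta> by auto
    then have "real (q n) \<le> \<beta> * (real (n + c) ^ Suc d + real (Suc d) * real b * real (n + c) ^ d)"
      using p(1)[of n] by (subst rec) (auto simp: \<alpha> algebra_simps split: if_splits)
    also have "\<dots> \<le> \<beta> * real (n + (c + b)) ^ Suc d"
      using power_Suc_increment_bounds(2)[of "real (n + c)" "real (n + (c + b))" d] \<beta>
      by (intro mult_left_mono) auto
    finally show ?case .
  qed
  show "\<alpha> / (real (Suc d) * real b) * real (n - c) ^ Suc d \<le> real (q n)"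
    unfolding \<beta>_def[symmetric]
  proof (induction n rule: less_induct)
    case (less n)
    have "\<beta> * real (n - c) ^ Suc d \<le> \<beta> * (real (n - b - c) ^ Suc d
        + real (Suc d) * (real (n - c) - real (n - b - c)) * real (n - c) ^ d)"
      using power_Suc_increment_bounds(1)[of "real (n - b - c)" "real (n - c)" d] \<beta>
      by (intro mult_left_mono) auto
    \<comment> \<open>Truncation can only shorten the step, so it is at most
      \<open>b\<close>.\<close>
    also have "\<dots> \<le> \<beta> * (real (n - b - c) ^ Suc d + real (Suc d) * real b * real (n - c) ^ d)"
      using \<beta> by (intro mult_left_mono add_left_mono mult_right_mono) auto
    also have "\<dots> = \<beta> * real (n - b - c) ^ Suc d + \<alpha> * real (n - c) ^ d"
      by (simp add: \<alpha> algebra_simps)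
    \<comment> \<open>For \<open>n < b\<close> the base \<open>n - b - c\<close> is 0 and the
      exponent is positive, so the left side vanishes.\<close>
    also have "\<beta> * real (n - b - c) ^ Suc d \<le> (if b \<le> n then real (q (n - b)) else 0)"
      using less[of "n - b"] \<open>b > 0\<close> by auto
    also have "\<alpha> * real (n - c) ^ d \<le> real (p n)"
      by (rule p)
    also have "(if b \<le> n then real (q (n - b)) else 0) + real (p n) = real (q n)"
      by (subst (2) rec) simp
    finally show ?case by simp
  qed
qed

text \<open>Induction on the remaining parts: each new part \<open>b\<close> raises the degree to
  some e and divides the coefficient by e b. The base is a consecutive pair because the count for a
  single part size above 1 oscillates between 0 and 1.\<close>

lemma card_partitions_into_bounds:
  assumes "finite A" "0 \<notin> A" "a \<in> A" "Suc a \<in> A"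
  defines "d \<equiv> card A - 1"
  defines "\<alpha> \<equiv> 1 / (fact d * real (\<Prod>A))"
  obtains c where "\<And>n. real (card (partitions_into A n)) \<le> \<alpha> * real (n + c) ^ d"
    and "\<And>n. \<alpha> * real (n - c) ^ d \<le> real (card (partitions_into A n))"
proof -
  have "a > 0"
    using assms by (auto intro!: gr0I)
  have "\<exists>c. \<forall>n. real (card (partitions_into (insert a (insert (Suc a) E)) n))
        \<le> 1 / (fact (Suc (card E)) * real (\<Prod>(insert a (insert (Suc a) E)))) * real (n + c) ^ Suc (card E)
      \<and> 1 / (fact (Suc (card E)) * real (\<Prod>(insert a (insert (Suc a) E)))) * real (n - c) ^ Suc (card E)
        \<le> real (card (partitions_into (insert a (insert (Suc a) E)) n))"
    if "finite E" "0 \<notin> E" "a \<notin> E" "Suc a \<notin> E" for E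
    using that
  proof (induction E rule: finite_induct)
    case empty
    show ?case
      using card_partitions_into_consecutive_bounds[OF \<open>a > 0\<close>]
      by (intro exI[of _ "a * Suc a"]) (simp add: field_simps)
  next
    case (insert b E)
    define A' where "A' = insert a (insert (Suc a) E)"
    define e where "e = Suc (card E)"
    define \<beta> where "\<beta> = 1 / (fact e * real (\<Prod>A'))"
    have b: "b \<notin> A'" "0 \<notin> A'" "b > 0" "finite A'"
      using insert \<open>a > 0\<close> by (auto simp: A'_def)
    have "\<exists>c. \<forall>n. real (card (partitions_into A' n)) \<le> \<beta> * real (n + c) ^ e
        \<and> \<beta> * real (n - c) ^ e \<le> real (card (partitions_into A' n))"
      unfolding A'_def \<beta>_def e_def using insert.prems by (intro insert.IH) auto
    then obtain c where c: "\<And>n. real (card (partitions_into A' n)) \<le> \<beta> * real (n + c) ^ e"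
      "\<And>n. \<beta> * real (n - c) ^ e \<le> real (card (partitions_into A' n))"
      by blast
    have "\<beta> \<ge> 0"
      by (simp add: \<beta>_def prod_nonneg)
    note bounds = shifted_power_bounds_recurrence[OF b(3) this card_partitions_into_insert[OF b(1-3)] c]
    have \<beta>: "\<beta> / (real (Suc e) * real b) = 1 / (fact (Suc e) * real (\<Prod>(insert b A')))"
      using b by (simp add: \<beta>_def mult_ac)
    have A': "insert a (insert (Suc a) (insert b E)) = insert b A'"
      by (auto simp: A'_def)
    have e: "Suc (card (insert b E)) = Suc e"
      using insert by (simp add: e_def)
    show ?case
      unfolding A' e
    proof (intro exI[of _ "c + b"] allI conjI)
      fix n
      show "real (card (partitions_into (insert b A') n))
          \<le> 1 / (fact (Suc e) * real (\<Prod>(insert b A'))) * real (n + (c + b)) ^ Suc e"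
        using bounds(1)[of n] unfolding \<beta> .
      \<comment> \<open>The lower bound is weakened from shift \<open>c\<close> to
        \<open>c + b\<close> so that one constant serves both bounds.\<close>
      have "1 / (fact (Suc e) * real (\<Prod>(insert b A'))) * real (n - (c + b)) ^ Suc e
          \<le> 1 / (fact (Suc e) * real (\<Prod>(insert b A'))) * real (n - c) ^ Suc e"
        by (intro mult_left_mono power_mono divide_nonneg_nonneg mult_nonneg_nonneg)
          (auto intro!: prod_nonneg)
      also have "\<dots> \<le> real (card (partitions_into (insert b A') n))"
        using bounds(2)[of n] unfolding \<beta> .
      finally show "1 / (fact (Suc e) * real (\<Prod>(insert b A'))) * real (n - (c + b)) ^ Suc e
          \<le> real (card (partitions_into (insert b A') n))" .
    qed
  qed
  note * = this[of "A - {a, Suc a}"]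
  have "insert a (insert (Suc a) (A - {a, Suc a})) = A"
    using assms by auto
  moreover have "Suc (card (A - {a, Suc a})) = d"
  proof -
    have "card {a, Suc a} \<le> card A"
      using assms by (intro card_mono) auto
    then show ?thesis
      using assms by (simp add: d_def card_Diff_subset)
  qed
  ultimately have "\<exists>c. \<forall>n. real (card (partitions_into A n)) \<le> \<alpha> * real (n + c) ^ d
      \<and> \<alpha> * real (n - c) ^ d \<le> real (card (partitions_into A n))"
    using * assms by (simp add: \<alpha>_def)
  then show ?thesis
    using that by blast
qed

section \<open>The two counts in terms of part sets\<close>

lemma c2_count_eq: "c2_count L s n = card (partitions_into {s+1..s+L} n)"
proof -
  have "0 < i" if "i \<in># p" "set_mset p \<subseteq> {s+1..s+L}" for i p
    using subsetD[OF that(2,1)] by simp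
  then show ?thesis
    unfolding c2_count_def partitions_into_def partitions_of_def
    by (intro arg_cong[of _ _ card]) blast
qed

text \<open>Adding one part \<open>s\<close> is injective and makes \<open>s\<close> the smallest
  part; as \<open>k \<noteq> s\<close>, the part \<open>k\<close> stays absent.\<close>

lemma f_count_ge:
  assumes "s \<ge> 1" "k \<noteq> s" "s \<le> n"
  shows "card (partitions_into ({s..s+L} - {k}) (n - s)) \<le> f_count L s k n"
proof -
  have "add_mset s ` partitions_into ({s..s+L} - {k}) (n - s) \<subseteq> {p \<in> partitions_of n.
      p \<noteq> {#} \<and> Min (set_mset p) = s \<and> Max (set_mset p) \<le> L + s \<and> k \<notin># p}"
  proof safe
    fix p assume "p \<in> partitions_into ({s..s+L} - {k}) (n - s)"
    then have p: "set_mset p \<subseteq> {s..s+L} - {k}" "sum_mset p = n - s"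
      by (auto simp: partitions_into_def)
    show "add_mset s p \<in> partitions_of n"
      using p assms by (auto simp: partitions_of_def subset_iff Suc_le_eq)
    show "Min (set_mset (add_mset s p)) = s"
      using p by (intro Min_eqI) auto
    show "Max (set_mset (add_mset s p)) \<le> L + s"
      using p by (auto simp: subset_iff add.commute)
    show False if "k \<in># add_mset s p"
      using that p assms by auto
  qed auto
  then have "card (add_mset s ` partitions_into ({s..s+L} - {k}) (n - s)) \<le> f_count L s k n"
    unfolding f_count_def by (intro card_mono) (auto simp: finite_partitions_of)
  then show ?thesis
    by (subst (asm) card_image) (auto intro: inj_onI)
qed

section \<open>Comparison for large \<open>n\<close>\<close>

text \<open>The ratio (n+c)/(n-e) tends to 1, so a strict gap between coefficients absorbs fixed
  shifts. Replacing \<open>n\<close> by \<open>n + e\<close> first avoids truncated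
  subtraction.\<close>

lemma eventually_shifted_power_le:
  fixes \<alpha> \<beta> :: real
  assumes "\<alpha> < \<beta>"
  shows "\<forall>\<^sub>F n in sequentially. \<alpha> * real (n + c) ^ d \<le> \<beta> * real (n - e) ^ d"
proof -
  have "(\<lambda>n. \<alpha> * (real (n + e + c) / real n) ^ d) \<longlonglongrightarrow> \<alpha> * 1 ^ d"
  proof (intro tendsto_intros)
    have "(\<lambda>n. 1 + real (e + c) * inverse (real n)) \<longlonglongrightarrow> 1 + real (e + c) * 0"
      by (intro tendsto_intros lim_inverse_n)
    moreover have "\<forall>\<^sub>F n in sequentially.
        1 + real (e + c) * inverse (real n) = real (n + e + c) / real n"
      using eventually_gt_at_top[of 0] by eventually_elim (simp add: field_simps)
    ultimately show "(\<lambda>n. real (n + e + c) / real n) \<longlonglongrightarrow> 1"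
      by (simp add: tendsto_cong)
  qed
  then have "\<forall>\<^sub>F n in sequentially. \<alpha> * (real (n + e + c) / real n) ^ d < \<beta>"
    using assms by (intro order_tendstoD) auto
  then have "\<forall>\<^sub>F n in sequentially. \<alpha> * real (n + e + c) ^ d \<le> \<beta> * real n ^ d"
    using eventually_gt_at_top[of 0] by eventually_elim (simp add: power_divide field_simps)
  then have "\<forall>\<^sub>F n in sequentially. \<alpha> * real (n + e + c) ^ d \<le> \<beta> * real (n + e - e) ^ d"
    by simp
  then show ?thesis
    by (subst (asm) eventually_sequentially_seg[of "\<lambda>n. \<alpha> * real (n + c) ^ d \<le> \<beta> * real (n - e) ^ d"])
qed

lemma eventually_c2_count_le_f_count:
  assumes "s \<ge> 1" "L \<ge> 3" "s < k" "k \<le> s + L"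
  shows "\<forall>\<^sub>F n in sequentially. c2_count L s n \<le> f_count L s k n"
proof -
  define B where "B = {s..s+L} - {k}"
  define C where "C = {s+1..s+L}"
  \<comment> \<open>\<open>D\<close> is the common part of both sets: \<open>B\<close> adds
    \<open>s\<close> and \<open>C\<close> adds \<open>k\<close>, so the degrees agree and the
    products differ only in the factor \<open>s\<close> or \<open>k\<close>.\<close>
  define D where "D = {s+1..s+L} - {k}"
  have BC: "B = insert s D" "C = insert k D" and D: "s \<notin> D" "k \<notin> D" "finite D" "0 \<notin> D"
    using assms by (auto simp: B_def C_def D_def)
  define d where "d = card D"
  have card: "card B - 1 = d" "card C - 1 = d"
    using D by (simp_all add: BC d_def)
  \<comment> \<open>Removing \<open>k = s + 1\<close> leaves the pair \<open>s + 2\<close>,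
    \<open>s + 3\<close>, since \<open>L \<ge> 3\<close>; otherwise \<open>s\<close>,
    \<open>s + 1\<close> survives.\<close>
  obtain a where a: "a \<in> B" "Suc a \<in> B"
  proof (cases "k = s + 1")
    case True
    with assms that[of "s + 2"] show ?thesis
      by (auto simp: B_def)
  next
    case False
    with assms that[of s] show ?thesis
      by (auto simp: B_def)
  qed
  have fin: "finite B" "0 \<notin> B" "finite C" "0 \<notin> C" "s + 1 \<in> C" "Suc (s + 1) \<in> C"
    using assms by (auto simp: B_def C_def)
  define \<beta> \<gamma> where "\<beta> = 1 / (fact d * real (\<Prod>B))" and "\<gamma> = 1 / (fact d * real (\<Prod>C))"
  obtain c where c: "\<And>n. real (card (partitions_into C n)) \<le> \<gamma> * real (n + c) ^ d"
    by (rule card_partitions_into_bounds[OF fin(3-6), unfolded card, folded \<gamma>_def]) blast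
  obtain e where e: "\<And>n. \<beta> * real (n - e) ^ d \<le> real (card (partitions_into B n))"
    by (rule card_partitions_into_bounds[OF fin(1,2) a, unfolded card, folded \<beta>_def]) blast
  have "real (\<Prod>D) > 0"
    using D by (auto intro!: prod_pos gr0I)
  moreover have "real (\<Prod>B) = real s * real (\<Prod>D)" "real (\<Prod>C) = real k * real (\<Prod>D)"
    using D by (simp_all add: BC)
  ultimately have "\<gamma> < \<beta>"
    using assms unfolding \<beta>_def \<gamma>_def by (simp only:) (simp add: field_simps)
  \<comment> \<open>The shift \<open>s + e\<close> combines the removed part \<open>s\<close> with
    the error shift \<open>e\<close> for \<open>B\<close>.\<close>
  from eventually_shifted_power_le[OF this, of c d "s + e"] eventually_ge_at_top[of s]
  show ?thesis
  proof eventually_elim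
    case (elim n)
    have "real (c2_count L s n) \<le> \<gamma> * real (n + c) ^ d"
      using c unfolding c2_count_eq C_def .
    also have "\<dots> \<le> \<beta> * real (n - s - e) ^ d"
      using elim by simp
    also have "\<dots> \<le> real (card (partitions_into B (n - s)))"
      by (rule e)
    also have "\<dots> \<le> real (f_count L s k n)"
      using f_count_ge[of s k n L] assms elim by (simp add: B_def)
    finally show ?case
      by simp
  qed
qed

theorem theorem2p1:
  fixes s L :: nat
  assumes "s \<ge> 1" and "L \<ge> 3"
  shows "\<exists>M::nat. \<forall>k n. max (s + 1) L \<le> k \<longrightarrow> k \<le> s + L \<longrightarrow> n \<ge> M \<longrightarrow>
           f_count L s k n \<ge> c2_count L s n"
proof -
  \<comment> \<open>Each \<open>k\<close> has its own threshold; there are finitely many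
    \<open>k\<close>, so one \<open>M\<close> serves them all.\<close>
  have "\<forall>\<^sub>F n in sequentially. \<forall>k\<in>{s<..s+L}. c2_count L s n \<le> f_count L s k n"
    using assms by (intro eventually_ball_finite ballI eventually_c2_count_le_f_count) auto
  then obtain M where "\<forall>n\<ge>M. \<forall>k\<in>{s<..s+L}. c2_count L s n \<le> f_count L s k n"
    unfolding eventually_sequentially by blast
  then show ?thesis
    by (intro exI[of _ M]) auto
qed

end
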